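(* Let $T\in\mathbb{B}(\mathcal{H})$ be a bounded linear operator on a complex Hilbert space $\mathcal{H}$ and let $\lambda\in(0,1)$. Then the following statements are equivalent: (i) $\|M_\lambda(T)\|=\|T\|$. (ii) There exists a sequence of unit vectors $\{x_n\}$ in $\mathcal{H}$ such that $\lim_{n\to+\infty}\langle Tx_n,T^Dx_n\rangle=\|T\|^2$.
   Context: $\mathbb{B}(\mathcal{H})$ is the algebra of bounded linear operators on the complex Hilbert space $\mathcal{H}$ and $\|\cdot\|$ is the operator norm. $T=U|T|$ denotes the canonical polar decomposition: $|T|=(T^*T)^{1/2}$ and $U$ is the unique partial isometry with $T=U|T|$ and $\mathcal{N}(U)=\mathcal{N}(T)$ (null spaces). The Duggal transform of $T$ is $T^D:=|T|U$. For $\lambda\in[0,1]$ the $\lambda$-mean transform of $T$ is $M_\lambda(T):=\lambda T+(1-\lambda)T^D$. *)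

theory Defs
  imports "HOL-Analysis.Analysis"
begin

text \<open>
  A complex Hilbert space is rendered as a complete \<^class>\<open>real_inner\<close> space that also carries a
  complex scalar multiplication and a sesquilinear inner product \<open>cinner\<close>, linear in the first
  argument. The axioms \<open>scaleR_scaleC\<close> and \<open>inner_eq_Re_cinner\<close> say that the real structure is the
  one underlying the complex structure. Definiteness of \<open>cinner\<close> and
  \<open>cinner x x = (norm x)\<^sup>2\<close> then follow from the axioms of \<^class>\<open>real_inner\<close> and \<open>cinner_commute\<close>.
\<close>

class chilbert_space = real_inner + complete_space +
  fixes scaleC :: "complex \<Rightarrow> 'a \<Rightarrow> 'a"  (infixr "*\<^sub>C" 75)
    and cinner :: "'a \<Rightarrow> 'a \<Rightarrow> complex"
  assumes scaleC_add_right: "c *\<^sub>C (x + y) = c *\<^sub>C x + c *\<^sub>C y"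
    and scaleC_add_left: "(c + d) *\<^sub>C x = c *\<^sub>C x + d *\<^sub>C x"
    and scaleC_scaleC: "c *\<^sub>C (d *\<^sub>C x) = (c * d) *\<^sub>C x"
    and scaleR_scaleC: "r *\<^sub>R x = complex_of_real r *\<^sub>C x"
    and cinner_commute: "cinner x y = cnj (cinner y x)"
    and cinner_add_left: "cinner (x + y) z = cinner x z + cinner y z"
    and cinner_scaleC_left: "cinner (c *\<^sub>C x) y = c * cinner x y"
    and inner_eq_Re_cinner: "inner x y = Re (cinner x y)"

instantiation complex :: chilbert_space
begin

definition scaleC_complex :: "complex \<Rightarrow> complex \<Rightarrow> complex"
  where "scaleC_complex c x = c * x"

definition cinner_complex :: "complex \<Rightarrow> complex \<Rightarrow> complex"
  where "cinner_complex x y = x * cnj y"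

instance
  by standard
    (auto simp: scaleC_complex_def cinner_complex_def inner_complex_def scaleR_conv_of_real
      algebra_simps)

end

definition bounded_clinear :: "('a::chilbert_space \<Rightarrow> 'a) \<Rightarrow> bool"
  where "bounded_clinear T \<longleftrightarrow> bounded_linear T \<and> (\<forall>c x. T (c *\<^sub>C x) = c *\<^sub>C T x)"

definition cadjoint :: "('a::chilbert_space \<Rightarrow> 'a) \<Rightarrow> 'a \<Rightarrow> 'a"
  where "cadjoint T = (THE S. \<forall>x y. cinner (T x) y = cinner x (S y))"

definition positive_op :: "('a::chilbert_space \<Rightarrow> 'a) \<Rightarrow> bool"
  where "positive_op A \<longleftrightarrow> bounded_clinear A \<and> (\<forall>x. cinner (A x) x \<in> \<real>\<^sub>\<ge>\<^sub>0)"

definition sqrt_op :: "('a::chilbert_space \<Rightarrow> 'a) \<Rightarrow> 'a \<Rightarrow> 'a"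
  where "sqrt_op A = (THE P. positive_op P \<and> P \<circ> P = A)"

definition abs_op :: "('a::chilbert_space \<Rightarrow> 'a) \<Rightarrow> 'a \<Rightarrow> 'a"
  where "abs_op T = sqrt_op (cadjoint T \<circ> T)"

definition null_space :: "('a::chilbert_space \<Rightarrow> 'a) \<Rightarrow> 'a set"
  where "null_space T = {x. T x = 0}"

text \<open>A partial isometry is isometric on the orthogonal complement of its null space.\<close>

definition partial_isometry :: "('a::chilbert_space \<Rightarrow> 'a) \<Rightarrow> bool"
  where "partial_isometry U \<longleftrightarrow>
    bounded_clinear U \<and> (\<forall>x. (\<forall>z\<in>null_space U. cinner x z = 0) \<longrightarrow> norm (U x) = norm x)"

definition polar_isometry :: "('a::chilbert_space \<Rightarrow> 'a) \<Rightarrow> 'a \<Rightarrow> 'a"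
  where "polar_isometry T =
    (THE U. partial_isometry U \<and> T = U \<circ> abs_op T \<and> null_space U = null_space T)"

definition duggal_transform :: "('a::chilbert_space \<Rightarrow> 'a) \<Rightarrow> 'a \<Rightarrow> 'a"
  where "duggal_transform T = abs_op T \<circ> polar_isometry T"

definition mean_transform :: "real \<Rightarrow> ('a::chilbert_space \<Rightarrow> 'a) \<Rightarrow> 'a \<Rightarrow> 'a"
  where "mean_transform t T = (\<lambda>x. t *\<^sub>R T x + (1 - t) *\<^sub>R duggal_transform T x)"

end

theory Submission
  imports Defs
begin

text \<open>
  Write \<open>D\<close> for the Duggal transform and \<open>K = \<parallel>T\<parallel>\<close>. Since \<open>\<parallel>|T| z\<parallel> = \<parallel>T z\<parallel>\<close> and the polar isometry
  is a contraction, \<open>\<parallel>D x\<parallel> \<le> K \<parallel>x\<parallel>\<close>. Everything then follows from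
  \<open>\<parallel>t T x + (1 - t) D x\<parallel>\<^sup>2 = t\<^sup>2 \<parallel>T x\<parallel>\<^sup>2 + (1 - t)\<^sup>2 \<parallel>D x\<parallel>\<^sup>2 + 2 t (1 - t) Re \<langle>T x, D x\<rangle>\<close>:
  along unit vectors the left side can approach \<open>K\<^sup>2\<close> only if the real part does, and conversely
  \<open>\<parallel>T x - D x\<parallel>\<^sup>2 \<ge> 0\<close> forces all three terms to their maxima. As \<open>|\<langle>T x, D x\<rangle>| \<le> K\<^sup>2\<close>, the imaginary
  part then tends to \<open>0\<close>.

  The definite descriptions in the definitions are meaningful only once adjoint, square root and polar
  decomposition are known to exist uniquely. The square root of a scaled \<open>T\<^sup>* T = 1 - B\<close> with
  \<open>\<parallel>B\<parallel> \<le> 1\<close> is the binomial series of \<open>(1 - B)\<^sup>1\<^sup>/\<^sup>2\<close>, whose coefficients are absolutely summable.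
\<close>

section \<open>Complex inner product\<close>

instance chilbert_space \<subseteq> banach ..

text \<open>The real form determines the complex one, so most arguments below use
  \<open>inner\<close> and return to \<open>cinner\<close> only at the end.\<close>

lemma Im_cinner: "Im (cinner x y) = - inner (\<i> *\<^sub>C x) y"
  by (simp add: inner_eq_Re_cinner cinner_scaleC_left)

lemma cinner_scaleC_right: "cinner x (c *\<^sub>C y) = cnj c * cinner x y"
  by (metis cinner_commute cinner_scaleC_left complex_cnj_mult)

lemma cinner_add_right: "cinner x (y + z) = cinner x y + cinner x z"
  by (metis cinner_add_left cinner_commute complex_cnj_add)

lemma cinner_self: "cinner x x = complex_of_real ((norm x)\<^sup>2)"
proof -
  have "Im (cinner x x) = 0"
    using arg_cong[OF cinner_commute[of x x], of Im] by simp
  then show ?thesis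
    by (simp add: complex_eq_iff power2_norm_eq_inner inner_eq_Re_cinner)
qed

lemma norm_scaleC: "norm (c *\<^sub>C x) = cmod c * norm x" for x :: "'a::chilbert_space"
proof -
  have "cinner (c *\<^sub>C x) (c *\<^sub>C x) = complex_of_real ((cmod c * norm x)\<^sup>2)"
    using cinner_self[of x] complex_norm_square[of c]
    by (simp add: cinner_scaleC_left cinner_scaleC_right power_mult_distrib)
  then have "(norm (c *\<^sub>C x))\<^sup>2 = (cmod c * norm x)\<^sup>2"
    unfolding cinner_self of_real_eq_iff .
  then show ?thesis by simp
qed

text \<open>Rotating \<open>x\<close> by a scalar of modulus 1 makes a nonzero product real and
  positive, which reduces the bound to the real Cauchy-Schwarz inequality.\<close>

lemma norm_cinner_le: "cmod (cinner x y) \<le> norm x * norm y"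
proof (cases "cinner x y = 0")
  case False
  define c where "c = cnj (sgn (cinner x y))"
  have c: "cmod c = 1" using False by (simp add: c_def norm_sgn)
  have "c * cinner x y = complex_of_real (cmod (cinner x y))"
    using False by (simp add: c_def sgn_eq divide_simps complex_norm_square[symmetric] power2_eq_square mult.commute)
  then have "cmod (cinner x y) = inner (c *\<^sub>C x) y"
    by (simp add: inner_eq_Re_cinner cinner_scaleC_left)
  also have "\<dots> \<le> norm (c *\<^sub>C x) * norm y" by (rule norm_cauchy_schwarz)
  finally show ?thesis by (simp add: norm_scaleC c)
qed simp

lemma bounded_clinear_compose:
  "bounded_clinear S \<Longrightarrow> bounded_clinear T \<Longrightarrow> bounded_clinear (S \<circ> T)"
  by (auto simp: bounded_clinear_def o_def intro: bounded_linear_compose)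

text \<open>Evaluating the hypothesis at \<open>\<i> *\<^sub>C x\<close> recovers the imaginary
  parts.\<close>

lemma inner_eq_imp_cinner_eq:
  assumes "bounded_clinear S" "bounded_clinear T" and "\<And>x. inner (S x) u = inner (T x) v"
  shows "cinner (S x) u = cinner (T x) v"
proof (rule complex_eqI)
  show "Re (cinner (S x) u) = Re (cinner (T x) v)"
    using assms(3)[of x] by (simp add: inner_eq_Re_cinner)
  show "Im (cinner (S x) u) = Im (cinner (T x) v)"
    using assms(3)[of "\<i> *\<^sub>C x"] assms(1,2) by (simp add: Im_cinner bounded_clinear_def)
qed

lemma bounded_clinear_id: "bounded_clinear (\<lambda>x. x)"
  by (simp add: bounded_clinear_def bounded_linear_ident)

lemma bounded_clinear_linear: "bounded_clinear T \<Longrightarrow> linear T"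
  by (simp add: bounded_clinear_def bounded_linear.linear)

lemma inner_scaleC_right: "inner x (c *\<^sub>C y) = inner (cnj c *\<^sub>C x) y"
  by (simp add: inner_eq_Re_cinner cinner_scaleC_left cinner_scaleC_right)

lemma bounded_linear_scaleC: "bounded_linear ((*\<^sub>C) c :: 'a::chilbert_space \<Rightarrow> 'a)"
  by (rule bounded_linear_intro[where K="cmod c"])
     (simp_all add: scaleC_add_right scaleR_scaleC scaleC_scaleC norm_scaleC mult.commute)

section \<open>Riesz representation and adjoints\<close>

text \<open>First-order condition at a minimum: were \<open>a\<close> nonzero, the step
  \<open>s = - a / c\<close> with \<open>c > 0\<close> and \<open>c > b\<close> would make the
  expression negative.\<close>

lemma quadratic_nonneg_imp_zero:
  fixes a b :: real
  assumes "\<And>s. 0 \<le> s * a + s\<^sup>2 * b"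
  shows "a = 0"
proof (rule ccontr)
  assume "a \<noteq> 0"
  define c where "c = \<bar>b\<bar> + 1"
  have c: "c > 0" "b < c" by (auto simp: c_def)
  have "0 \<le> (- a / c) * a + (- a / c)\<^sup>2 * b" by (rule assms)
  also have "\<dots> = (a\<^sup>2 / c) * (b / c - 1)"
    using c by (simp add: field_simps power2_eq_square)
  finally show False using c \<open>a \<noteq> 0\<close> by (simp add: zero_le_mult_iff divide_simps)
qed

text \<open>The representing vector is the limit of \<open>L y\<close> along a minimising sequence of
  \<open>\<parallel>L y\<parallel>\<^sup>2 - 2 \<phi> y\<close>. Taking the range of an operator \<open>L\<close> instead of a closed subspace gives Riesz
  representation, orthogonal projection and extension by continuity at once.\<close>

lemma riesz_on_range:
  fixes L :: "'b::real_vector \<Rightarrow> 'a::{real_inner,complete_space}" and \<phi> :: "'b \<Rightarrow> real"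
  assumes L: "linear L" and phi: "linear \<phi>" and le: "\<And>y. \<phi> y \<le> C * norm (L y)"
  shows "\<exists>u\<in>closure (range L). \<forall>y. inner (L y) u = \<phi> y"
proof -
  define q where "q y = (norm (L y))\<^sup>2 - 2 * \<phi> y" for y
  have lower: "- C\<^sup>2 \<le> q y" for y
  proof -
    have "0 \<le> (norm (L y) - C)\<^sup>2" by simp
    then show ?thesis using le[of y] by (simp add: q_def power2_diff algebra_simps)
  qed
  define m where "m = Inf (range q)"
  have bdd: "bdd_below (range q)" using lower by (rule bdd_belowI2)
  have m_le: "m \<le> q y" for y unfolding m_def by (rule cInf_lower[OF _ bdd]) auto
  have "\<exists>y. q y < m + inverse (real (Suc n))" for n
    using cInf_lessD[of "range q" "m + inverse (real (Suc n))"] by (auto simp: m_def)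
  then obtain Y where Y: "\<And>n. q (Y n) < m + inverse (real (Suc n))" by metis
  have expand: "q (y + s *\<^sub>R z) = q y + s * (2 * (inner (L z) (L y) - \<phi> z)) + s\<^sup>2 * (norm (L z))\<^sup>2"
    for y z s
  proof -
    have "(norm (L y + s *\<^sub>R L z))\<^sup>2 = (norm (L y))\<^sup>2 + 2 * s * inner (L z) (L y) + s\<^sup>2 * (norm (L z))\<^sup>2"
      unfolding power2_norm_eq_inner
      by (simp add: inner_add_left inner_add_right inner_commute power2_eq_square)
    then show ?thesis
      by (simp add: q_def linear_add[OF L] linear_scale[OF L] linear_add[OF phi] linear_scale[OF phi]
          algebra_simps)
  qed
  \<comment> \<open>Parallelogram law at the midpoint of \<open>y\<close> and \<open>z\<close>: two
    near-minimisers of \<open>q\<close> have nearby images under \<open>L\<close>.\<close>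
  have para: "(norm (L y - L z))\<^sup>2 = 2 * q y + 2 * q z - 4 * q (y + (1/2) *\<^sub>R (z - y))" for y z
  proof -
    have "(norm (L z - L y))\<^sup>2 = (norm (L z))\<^sup>2 - 2 * inner (L z) (L y) + (norm (L y))\<^sup>2"
      unfolding power2_norm_eq_inner
      by (simp add: inner_diff_left inner_diff_right inner_commute)
    then show ?thesis
      unfolding expand linear_diff[OF L] linear_diff[OF phi] norm_minus_commute[of "L y"]
      by (simp add: q_def inner_diff_left inner_diff_right inner_commute power2_norm_eq_inner
          power_divide field_simps)
  qed
  have dist_le: "(norm (L (Y i) - L (Y j)))\<^sup>2 \<le> 2 * inverse (real (Suc i)) + 2 * inverse (real (Suc j))" for i j
    using m_le[of "Y i + (1/2) *\<^sub>R (Y j - Y i)"] Y[of i] Y[of j] by (simp add: para)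
  have "Cauchy (\<lambda>n. L (Y n))"
  proof (rule metric_CauchyI)
    fix e :: real assume "0 < e"
    then obtain N where N: "inverse (real (Suc N)) < e\<^sup>2 / 4"
      using reals_Archimedean[of "e\<^sup>2 / 4"] by auto
    have "dist (L (Y i)) (L (Y j)) < e" if "i \<ge> N" "j \<ge> N" for i j
    proof -
      have "inverse (real (Suc i)) \<le> inverse (real (Suc N))" "inverse (real (Suc j)) \<le> inverse (real (Suc N))"
        using that by (simp_all add: le_imp_inverse_le)
      then have "(norm (L (Y i) - L (Y j)))\<^sup>2 < e\<^sup>2" using dist_le[of i j] N by linarith
      then show ?thesis using \<open>0 < e\<close> by (simp add: dist_norm power_less_imp_less_base)
    qed
    then show "\<exists>M. \<forall>i\<ge>M. \<forall>j\<ge>M. dist (L (Y i)) (L (Y j)) < e" by blast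
  qed
  then have "convergent (\<lambda>n. L (Y n))" by (rule Cauchy_convergent)
  then obtain u where u: "(\<lambda>n. L (Y n)) \<longlonglongrightarrow> u" by (auto simp: convergent_def)
  have "u \<in> closure (range L)"
    unfolding closure_sequential by (rule exI[of _ "\<lambda>n. L (Y n)"]) (simp add: u)
  moreover have "inner (L z) u = \<phi> z" for z
  proof -
    \<comment> \<open>The infimum need not be attained, so the first-order condition is passed to
      the limit \<open>u\<close> along the near-minimisers \<open>Y n\<close>.\<close>
    have "0 \<le> s * (2 * (inner (L z) u - \<phi> z)) + s\<^sup>2 * (norm (L z))\<^sup>2" for s
    proof (rule LIMSEQ_le)
      show "(\<lambda>n. - inverse (real (Suc n))) \<longlonglongrightarrow> 0"
        using tendsto_minus[OF LIMSEQ_inverse_real_of_nat] by simp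
      show "(\<lambda>n. s * (2 * (inner (L z) (L (Y n)) - \<phi> z)) + s\<^sup>2 * (norm (L z))\<^sup>2) \<longlonglongrightarrow>
        s * (2 * (inner (L z) u - \<phi> z)) + s\<^sup>2 * (norm (L z))\<^sup>2"
        by (intro tendsto_intros u)
      show "\<exists>N. \<forall>n\<ge>N. - inverse (real (Suc n)) \<le> s * (2 * (inner (L z) (L (Y n)) - \<phi> z)) + s\<^sup>2 * (norm (L z))\<^sup>2"
      proof (intro exI allI impI)
        fix n show "- inverse (real (Suc n)) \<le> s * (2 * (inner (L z) (L (Y n)) - \<phi> z)) + s\<^sup>2 * (norm (L z))\<^sup>2"
          using m_le[of "Y n + s *\<^sub>R z"] Y[of n] unfolding expand by linarith
      qed
    qed
    from quadratic_nonneg_imp_zero[OF this] show ?thesis by simp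
  qed
  ultimately show ?thesis by blast
qed

lemma orthogonal_to_closure:
  fixes M :: "'a::real_inner set"
  assumes "u \<in> closure M" "\<And>y. y \<in> M \<Longrightarrow> inner y v = 0"
  shows "inner u v = 0"
proof -
  obtain f where f: "\<And>n. f n \<in> M" "f \<longlonglongrightarrow> u"
    using assms(1) unfolding closure_sequential by blast
  have "(\<lambda>n. inner (f n) v) \<longlonglongrightarrow> inner u v" by (intro tendsto_intros f)
  then have "(\<lambda>n. 0) \<longlonglongrightarrow> inner u v" by (simp add: assms(2) f(1))
  then show ?thesis by (simp add: LIMSEQ_const_iff)
qed

text \<open>Riesz with the identity as \<open>L\<close> yields a real adjoint, and complex linearity
  lifts it to \<open>cinner\<close>. This settles existence in the description of
  \<open>cadjoint\<close>; uniqueness is nondegeneracy of \<open>inner\<close>.\<close>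

lemma cadjoint_inner:
  fixes T :: "'a::chilbert_space \<Rightarrow> 'a"
  assumes T: "bounded_clinear T"
  shows "inner (T x) y = inner x (cadjoint T y)"
proof -
  have bl: "bounded_linear T" using T by (simp add: bounded_clinear_def)
  have "\<exists>u. \<forall>z. inner z u = inner (T z) y" for y
  proof -
    have "\<exists>u\<in>closure (range (\<lambda>z. z)). \<forall>z. inner z u = inner (T z) y"
    proof (rule riesz_on_range)
      show "linear (\<lambda>z. inner (T z) y)"
        by (intro bounded_linear.linear bounded_linear_compose[OF bounded_linear_inner_left bl])
      fix z
      have "inner (T z) y \<le> norm (T z) * norm y" by (rule norm_cauchy_schwarz)
      also have "\<dots> \<le> (onorm T * norm z) * norm y" by (intro mult_right_mono onorm[OF bl]) simp
      finally show "inner (T z) y \<le> (onorm T * norm y) * norm z" by (simp add: mult_ac)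
    qed (simp add: linear_iff)
    then show ?thesis by blast
  qed
  then obtain S where S: "\<And>z y. inner z (S y) = inner (T z) y" by metis
  have S': "\<forall>x y. cinner (T x) y = cinner x (S y)"
    using inner_eq_imp_cinner_eq[OF T bounded_clinear_id] S by metis
  have "cadjoint T = S" unfolding cadjoint_def
  proof (rule the_equality[where P="\<lambda>S. \<forall>x y. cinner (T x) y = cinner x (S y)", OF S'])
    fix R assume "\<forall>x y. cinner (T x) y = cinner x (R y)"
    then have "inner x (R y) = inner x (S y)" for x y by (simp add: inner_eq_Re_cinner S')
    then show "R = S" by (meson ext vector_eq_ldot)
  qed
  then show ?thesis by (simp add: S)
qed

section \<open>The binomial series of the square root\<close>

text \<open>The coefficient of \<open>z ^ k\<close> in the binomial series of the square root of
  \<open>1 - z\<close>, sign included.\<close>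

definition sqrt_coeff :: "nat \<Rightarrow> real"
  where "sqrt_coeff k = (- 1) ^ k * ((1/2) gchoose k)"

lemma sqrt_coeff_0: "sqrt_coeff 0 = 1"
  by (simp add: sqrt_coeff_def)

text \<open>In \<open>pochhammer (- (1/2)) (Suc k)\<close> only the first factor is
  negative.\<close>

lemma sqrt_coeff_Suc_nonpos: "sqrt_coeff (Suc k) \<le> 0"
proof -
  have "sqrt_coeff (Suc k) = pochhammer (- (1/2)) (Suc k) / fact (Suc k)"
    by (simp only: sqrt_coeff_def gbinomial_pochhammer)
       (simp add: power_mult_distrib[symmetric] mult.assoc[symmetric] del: power_Suc)
  also have "\<dots> = - (1/2) * (pochhammer (1/2) k / fact (Suc k))"
    unfolding pochhammer_rec by simp
  also have "\<dots> \<le> 0"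
    using pochhammer_nonneg[of "1/2::real" k] by (intro mult_nonpos_nonneg divide_nonneg_pos) auto
  finally show ?thesis .
qed

text \<open>An alternating partial sum of binomial coefficients for 1/2 collapses to one signed
  coefficient for -1/2, a quotient of nonnegative numbers.\<close>

lemma sqrt_coeff_sum_nonneg: "0 \<le> (\<Sum>k<m. sqrt_coeff k)"
proof (cases m)
  case (Suc n)
  have "(\<Sum>k<m. sqrt_coeff k) = (- 1) ^ n * ((1/2 - 1) gchoose n)"
    unfolding Suc lessThan_Suc_atMost
    using gbinomial_sum_lower_neg[of "1/2::real" n] by (simp add: sqrt_coeff_def mult.commute)
  also have "\<dots> = pochhammer (1/2) n / fact n"
    by (simp only: gbinomial_pochhammer)
       (simp add: power_mult_distrib[symmetric] mult.assoc[symmetric])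
  also have "\<dots> \<ge> 0"
    using pochhammer_nonneg[of "1/2::real" n] by simp
  finally show ?thesis .
qed simp

text \<open>Only \<open>sqrt_coeff 0 = 1\<close> is positive, so an absolute partial sum is at most
  2 minus the plain one, which is nonnegative.\<close>

lemma sqrt_coeff_abs_summable: "summable (\<lambda>k. \<bar>sqrt_coeff k\<bar>)"
proof (rule summableI_nonneg_bounded)
  fix n
  have eq: "\<bar>sqrt_coeff k\<bar> = (if k = 0 then 2 else 0) - sqrt_coeff k" for k
    using sqrt_coeff_Suc_nonpos[of "k - 1"] by (cases k) (auto simp: sqrt_coeff_0)
  have "(\<Sum>k<n. \<bar>sqrt_coeff k\<bar>) = (\<Sum>k<n. if k = 0 then 2 else 0) - (\<Sum>k<n. sqrt_coeff k)"
    unfolding eq by (rule sum_subtractf)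
  also have "(\<Sum>k<n. if k = 0 then 2 else (0::real)) \<le> 2" by (simp add: sum.delta)
  finally show "(\<Sum>k<n. \<bar>sqrt_coeff k\<bar>) \<le> 2" using sqrt_coeff_sum_nonneg[of n] by linarith
qed simp

lemma sqrt_coeff_abs_summable_on: "(\<lambda>k. \<bar>sqrt_coeff k\<bar>) summable_on UNIV"
  using norm_summable_imp_summable_on[of "\<lambda>k. \<bar>sqrt_coeff k\<bar>"] sqrt_coeff_abs_summable by simp

lemma sqrt_coeff_summable_on: "sqrt_coeff summable_on UNIV"
  using norm_summable_imp_summable_on[of sqrt_coeff] sqrt_coeff_abs_summable by simp

text \<open>This is the series at \<open>z = 1\<close>; its sign will give positivity of the
  operator square root.\<close>

lemma sqrt_coeff_infsum_nonneg: "0 \<le> infsum sqrt_coeff UNIV"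
proof -
  have "sqrt_coeff sums infsum sqrt_coeff UNIV"
    by (intro has_sum_imp_sums has_sum_infsum sqrt_coeff_summable_on)
  then show ?thesis
    unfolding sums_def by (rule LIMSEQ_le_const) (use sqrt_coeff_sum_nonneg in blast)
qed

text \<open>Since 1/2 + 1/2 = 1, Vandermonde's identity leaves the coefficients of
  \<open>1 - z\<close>.\<close>

lemma sqrt_coeff_convolution:
  "(\<Sum>j\<le>n. sqrt_coeff j * sqrt_coeff (n - j)) = (if n = 0 then 1 else if n = 1 then - 1 else 0)"
proof -
  have "(\<Sum>j\<le>n. sqrt_coeff j * sqrt_coeff (n - j)) =
      (\<Sum>j\<le>n. (- 1) ^ n * (((1/2) gchoose j) * ((1/2) gchoose (n - j))))"
    by (rule sum.cong) (auto simp: sqrt_coeff_def mult_ac power_add[symmetric])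
  also have "\<dots> = (- 1) ^ n * ((1::real) gchoose n)"
    using gbinomial_Vandermonde[of "1/2::real" "1/2" n]
    by (simp add: sum_distrib_left[symmetric] atMost_atLeast0)
  also have "(1::real) gchoose n = of_nat (1 choose n)"
    using binomial_gbinomial[of 1 n, where ?'a=real] by simp
  finally show ?thesis
    by (cases n; cases "n - 1") (auto simp: binomial_eq_0)
qed

lemma infsum_bounded_linear:
  assumes "bounded_linear h" "f summable_on A"
  shows "h (infsum f A) = (\<Sum>\<^sub>\<infinity>x\<in>A. h (f x))"
  using has_sum_bounded_linear[OF assms(1) has_sum_infsum[OF assms(2)]] by (simp add: infsumI)

text \<open>The square root of \<open>1 - B\<close>, summed vector by vector, so that convergence
  takes place in the space itself. The sums are unordered, which permits rearranging the double
  series of the square.\<close>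

definition sqrt_series :: "('a::banach \<Rightarrow> 'a) \<Rightarrow> 'a \<Rightarrow> 'a"
  where "sqrt_series B x = (\<Sum>\<^sub>\<infinity>k. sqrt_coeff k *\<^sub>R (B ^^ k) x)"

context
  fixes B :: "'a::banach \<Rightarrow> 'a"
  assumes B: "bounded_linear B" and contraction: "\<And>x. norm (B x) \<le> norm x"
begin

lemma bounded_linear_funpow: "bounded_linear (B ^^ k)"
  by (induction k) (auto simp: id_def o_def intro: bounded_linear_ident bounded_linear_compose[OF B])

lemma norm_funpow_le: "norm ((B ^^ k) x) \<le> norm x"
  by (induction k) (auto intro: order_trans[OF contraction])

lemma sqrt_series_abs_summable_on:
  "(\<lambda>k. norm (sqrt_coeff k *\<^sub>R (B ^^ k) x)) summable_on UNIV"
  by (rule Infinite_Sum.abs_summable_on_comparison_test'[OF summable_on_cmult_left[OF sqrt_coeff_abs_summable_on, of "norm x"]])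
     (simp add: mult_left_mono norm_funpow_le)

lemma sqrt_series_summable_on:
  "(\<lambda>k. sqrt_coeff k *\<^sub>R (B ^^ k) x) summable_on UNIV"
  by (rule abs_summable_summable[OF sqrt_series_abs_summable_on])

text \<open>A bounded operator passes through the sum term by term. With scalar multiplication as
  \<open>C\<close> this also yields homogeneity of the series.\<close>

lemma sqrt_series_commute:
  assumes C: "bounded_linear C" and comm: "\<And>x. C (B x) = B (C x)"
  shows "C (sqrt_series B x) = sqrt_series B (C x)"
proof -
  have pow: "C ((B ^^ k) x) = (B ^^ k) (C x)" for k
    by (induction k) (auto simp: comm)
  have "C (sqrt_series B x) = (\<Sum>\<^sub>\<infinity>k. C (sqrt_coeff k *\<^sub>R (B ^^ k) x))"
    unfolding sqrt_series_def
    by (rule infsum_bounded_linear[OF C sqrt_series_summable_on])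
  then show ?thesis
    by (simp add: sqrt_series_def pow linear_scale[OF bounded_linear.linear[OF C]])
qed

lemma bounded_linear_sqrt_series: "bounded_linear (sqrt_series B)"
proof (rule bounded_linear_intro)
  show "sqrt_series B (x + y) = sqrt_series B x + sqrt_series B y" for x y
    unfolding sqrt_series_def infsum_add[OF sqrt_series_summable_on sqrt_series_summable_on, symmetric]
    by (simp add: linear_add[OF bounded_linear.linear[OF bounded_linear_funpow]] scaleR_add_right)
  show "sqrt_series B (r *\<^sub>R x) = r *\<^sub>R sqrt_series B x" for r x
    by (rule sqrt_series_commute[symmetric])
       (auto intro: bounded_linear_scaleR_right simp: linear_scale[OF bounded_linear.linear[OF B]])
  show "norm (sqrt_series B x) \<le> norm x * (\<Sum>\<^sub>\<infinity>k. \<bar>sqrt_coeff k\<bar>)" for x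
  proof -
    have "norm (sqrt_series B x) \<le> (\<Sum>\<^sub>\<infinity>k. \<bar>sqrt_coeff k\<bar> * norm x)"
      unfolding sqrt_series_def
      by (rule norm_infsum_le[OF has_sum_infsum has_sum_infsum])
         (auto intro: sqrt_series_summable_on summable_on_cmult_left sqrt_coeff_abs_summable_on
           mult_left_mono norm_funpow_le)
    then show ?thesis by (simp add: infsum_cmult_left' mult.commute[of "norm x"])
  qed
qed

text \<open>Cauchy product: the double family is absolutely summable, so it may be summed along
  antidiagonals, where \<open>sqrt_coeff_convolution\<close> leaves only the terms \<open>x\<close>
  and \<open>- B x\<close>.\<close>

lemma sqrt_series_square: "sqrt_series B (sqrt_series B x) = x - B x"
proof -
  define f where "f = (\<lambda>(j, k). (sqrt_coeff j * sqrt_coeff k) *\<^sub>R (B ^^ (j + k)) x)"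
  \<comment> \<open>A product family whose absolute values dominate the norms of \<open>f\<close>,
    because powers of \<open>B\<close> are contractions.\<close>
  define g where "g = (\<lambda>(j, k). sqrt_coeff j * (sqrt_coeff k * norm x))"
  have "(\<lambda>p. norm (g p)) summable_on (UNIV \<times> UNIV)"
    unfolding Infinite_Sum.abs_summable_on_Sigma_iff
    by (auto simp: g_def abs_mult infsum_cmult_left' infsum_cmult_right'
        intro!: summable_on_cmult_left summable_on_cmult_right sqrt_coeff_abs_summable_on)
  then have "(\<lambda>p. norm (f p)) summable_on (UNIV \<times> UNIV)"
    by (rule Infinite_Sum.abs_summable_on_comparison_test)
       (auto simp: f_def g_def abs_mult mult.assoc intro!: mult_left_mono norm_funpow_le)
  then have f: "f summable_on (UNIV \<times> UNIV)" by (rule abs_summable_summable)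
  \<comment> \<open>Reindexing by antidiagonals: \<open>n\<close> is the total exponent of
    \<open>B\<close> and \<open>j\<close> the part from the outer series.\<close>
  have bij: "bij_betw (\<lambda>(n, j). (j, n - j)) (SIGMA n:UNIV. {..n}) (UNIV \<times> UNIV :: (nat \<times> nat) set)"
    by (rule bij_betwI[where g="\<lambda>(j, k). (j + k, j)"]) auto
  have f': "(\<lambda>(n, j). f (j, n - j)) summable_on (SIGMA n:UNIV. {..n})"
    using f summable_on_reindex_bij_betw[OF bij, of f] by (simp add: case_prod_unfold)
  have "sqrt_series B (sqrt_series B x) =
      (\<Sum>\<^sub>\<infinity>j. \<Sum>\<^sub>\<infinity>k. sqrt_coeff j *\<^sub>R (B ^^ j) (sqrt_coeff k *\<^sub>R (B ^^ k) x))"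
    unfolding sqrt_series_def infsum_scaleR_right
    by (simp add: infsum_bounded_linear[OF bounded_linear_funpow sqrt_series_summable_on])
  also have "\<dots> = (\<Sum>\<^sub>\<infinity>j. \<Sum>\<^sub>\<infinity>k. f (j, k))"
    by (simp add: f_def funpow_add linear_scale[OF bounded_linear.linear[OF bounded_linear_funpow]])
  also have "\<dots> = infsum f (UNIV \<times> UNIV)" by (rule infsum_Sigma_banach[OF f])
  also have "\<dots> = (\<Sum>\<^sub>\<infinity>(n, j)\<in>(SIGMA n:UNIV. {..n}). f (j, n - j))"
    using infsum_reindex_bij_betw[OF bij, of f] by (simp add: case_prod_unfold)
  also have "\<dots> = (\<Sum>\<^sub>\<infinity>n. \<Sum>j\<le>n. f (j, n - j))"
    using infsum_Sigma_banach[OF f'] by simp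
  also have "\<dots> = (\<Sum>\<^sub>\<infinity>n. (if n = 0 then 1 else if n = 1 then - 1 else 0) *\<^sub>R (B ^^ n) x)"
    by (simp add: f_def scaleR_left.sum[symmetric] sqrt_coeff_convolution)
  also have "\<dots> = (\<Sum>\<^sub>\<infinity>n\<in>{0, 1}. (if n = 0 then 1 else if n = 1 then - 1 else 0) *\<^sub>R (B ^^ n) x)"
    by (rule infsum_cong_neutral) auto
  finally show ?thesis by simp
qed

end

text \<open>Termwise comparison with the coefficient sum times \<open>(norm x)\<^sup>2\<close>: for
  \<open>k > 0\<close> a nonpositive coefficient meets
  \<open>inner ((B ^^ k) x) x \<le> (norm x)\<^sup>2\<close>, and at \<open>k = 0\<close> both terms
  agree.\<close>

lemma sqrt_series_nonneg:
  fixes B :: "'a::{real_inner,banach} \<Rightarrow> 'a"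
  assumes B: "bounded_linear B" and contraction: "\<And>x. norm (B x) \<le> norm x"
  shows "0 \<le> inner (sqrt_series B x) x"
proof -
  note sm = sqrt_series_summable_on[OF B contraction]
  have "0 \<le> (\<Sum>\<^sub>\<infinity>k. sqrt_coeff k) * (norm x)\<^sup>2"
    using sqrt_coeff_infsum_nonneg by simp
  also have "\<dots> = (\<Sum>\<^sub>\<infinity>k. sqrt_coeff k * (norm x)\<^sup>2)"
    by (rule infsum_cmult_left'[symmetric])
  also have "\<dots> \<le> (\<Sum>\<^sub>\<infinity>k. inner (sqrt_coeff k *\<^sub>R (B ^^ k) x) x)"
  proof (rule infsum_mono)
    fix k
    have "inner ((B ^^ k) x) x \<le> norm ((B ^^ k) x) * norm x" by (rule norm_cauchy_schwarz)
    also have "\<dots> \<le> norm x * norm x" by (intro mult_right_mono norm_funpow_le[OF B contraction]) simp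
    finally have "inner ((B ^^ k) x) x \<le> (norm x)\<^sup>2" by (simp add: power2_eq_square)
    then show "sqrt_coeff k * (norm x)\<^sup>2 \<le> inner (sqrt_coeff k *\<^sub>R (B ^^ k) x) x"
      using sqrt_coeff_Suc_nonpos[of "k - 1"]
      by (cases k) (auto simp: power2_norm_eq_inner intro: mult_left_mono_neg simp del: funpow.simps(2))
  qed (intro summable_on_cmult_left sqrt_coeff_summable_on
        summable_on_bounded_linear[OF bounded_linear_inner_left sm])+
  also have "\<dots> = inner (sqrt_series B x) x"
    unfolding sqrt_series_def
    by (rule infsum_bounded_linear[OF bounded_linear_inner_left sm, symmetric])
  finally show ?thesis .
qed

lemma sqrt_series_symmetric:
  fixes B :: "'a::{real_inner,banach} \<Rightarrow> 'a"
  assumes B: "bounded_linear B" and contraction: "\<And>x. norm (B x) \<le> norm x"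
    and sym: "\<And>x y. inner (B x) y = inner x (B y)"
  shows "inner (sqrt_series B x) y = inner x (sqrt_series B y)"
proof -
  note sm = sqrt_series_summable_on[OF B contraction]
  have pow: "inner ((B ^^ k) x) y = inner x ((B ^^ k) y)" for k x y
    by (induction k arbitrary: y) (auto simp: sym simp flip: funpow_swap1)
  have "inner (sqrt_series B x) y = (\<Sum>\<^sub>\<infinity>k. inner (sqrt_coeff k *\<^sub>R (B ^^ k) x) y)"
    unfolding sqrt_series_def
    by (rule infsum_bounded_linear[OF bounded_linear_inner_left sm])
  also have "\<dots> = (\<Sum>\<^sub>\<infinity>k. inner x (sqrt_coeff k *\<^sub>R (B ^^ k) y))"
    by (simp add: pow)
  also have "\<dots> = inner x (sqrt_series B y)"
    unfolding sqrt_series_def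
    by (rule infsum_bounded_linear[OF bounded_linear_inner_right sm, symmetric])
  finally show ?thesis .
qed

section \<open>Positive operators and square roots\<close>

text \<open>Multiplication by \<open>\<i>\<close> is skew for \<open>inner\<close> and commutes with
  \<open>P\<close>, so \<open>inner (\<i> *\<^sub>C P x) x\<close> equals its own negative and
  \<open>cinner (P x) x\<close> is real.\<close>

lemma positive_opI:
  assumes P: "bounded_clinear P" and sym: "\<And>x y. inner (P x) y = inner x (P y)"
    and pos: "\<And>x. 0 \<le> inner (P x) x"
  shows "positive_op P"
  unfolding positive_op_def
proof (intro conjI allI P)
  fix x
  have "inner (P (\<i> *\<^sub>C x)) x = inner (\<i> *\<^sub>C x) (P x)" by (rule sym)
  moreover have "\<i> *\<^sub>C P x = P (\<i> *\<^sub>C x)" using P by (simp add: bounded_clinear_def)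
  moreover have "inner (\<i> *\<^sub>C x) (P x) = - inner x (\<i> *\<^sub>C P x)"
    by (simp add: inner_eq_Re_cinner cinner_scaleC_left cinner_scaleC_right)
  ultimately have "Im (cinner (P x) x) = 0"
    by (simp add: Im_cinner inner_commute)
  then show "cinner (P x) x \<in> \<real>\<^sub>\<ge>\<^sub>0"
    using pos[of x] by (simp add: complex_nonneg_Reals_iff inner_eq_Re_cinner)
qed

lemma positive_op_nonneg: "positive_op P \<Longrightarrow> 0 \<le> inner (P x) x"
  by (simp add: positive_op_def complex_nonneg_Reals_iff inner_eq_Re_cinner)

text \<open>Polarisation: the form is real at \<open>y + \<i> *\<^sub>C x\<close>, and the imaginary
  part contributed there by the cross terms is the difference of the two sides.\<close>

lemma positive_op_symmetric:
  assumes P: "positive_op P"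
  shows "inner (P x) y = inner x (P y)"
proof -
  have clin: "bounded_clinear P" using P by (simp add: positive_op_def)
  have real: "Im (cinner (P z) z) = 0" for z
    using P by (simp add: positive_op_def complex_nonneg_Reals_iff)
  have "Im (cinner (P (y + \<i> *\<^sub>C x)) (y + \<i> *\<^sub>C x)) =
      Im (cinner (P y) y) + Im (cinner (P x) x) + Re (cinner (P x) y) - Re (cinner (P y) x)"
    using clin by (simp add: linear_add[OF bounded_clinear_linear[OF clin]] bounded_clinear_def
        cinner_add_left cinner_add_right cinner_scaleC_left cinner_scaleC_right)
  then show ?thesis
    by (simp add: real inner_commute[of x] inner_eq_Re_cinner[of "P _"])
qed

text \<open>The form attains its minimum 0 at \<open>y\<close>; moving \<open>y\<close> in the
  direction \<open>P y\<close> forces the linear coefficient \<open>2 * (norm (P y))\<^sup>2\<close>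
  to vanish.\<close>

lemma positive_op_inner_eq_0:
  assumes P: "positive_op P" and "inner (P y) y = 0"
  shows "P y = 0"
proof -
  have lin: "linear P" using P by (simp add: positive_op_def bounded_clinear_linear)
  have "0 \<le> s * (2 * (norm (P y))\<^sup>2) + s\<^sup>2 * inner (P (P y)) (P y)" for s
  proof -
    have "0 \<le> inner (P (y + s *\<^sub>R P y)) (y + s *\<^sub>R P y)" by (rule positive_op_nonneg[OF P])
    also have "\<dots> = s * (2 * (norm (P y))\<^sup>2) + s\<^sup>2 * inner (P (P y)) (P y)"
      using assms(2) positive_op_symmetric[OF P, of "P y" y] unfolding power2_norm_eq_inner
      by (simp add: linear_add[OF lin] linear_scale[OF lin] inner_add_left inner_add_right power2_eq_square
          algebra_simps)
    finally show ?thesis .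
  qed
  from quadratic_nonneg_imp_zero[OF this] show ?thesis by simp
qed

lemma commuting_positive_sqrt_unique:
  assumes P: "positive_op P" and Q: "positive_op Q"
    and sq: "P \<circ> P = Q \<circ> Q" and comm: "\<And>x. P (Q x) = Q (P x)"
  shows "P = Q"
proof
  fix x
  have linP: "linear P" and linQ: "linear Q"
    using P Q by (simp_all add: positive_op_def bounded_clinear_linear)
  \<comment> \<open>\<open>(P + Q) y = (P\<^sup>2 - Q\<^sup>2) x = 0\<close>, so both nonnegative forms vanish at \<open>y\<close>, whence \<open>(P - Q)\<^sup>2 x = 0\<close>.\<close>
  define y where "y = P x - Q x"
  have "P y + Q y = 0"
    using fun_cong[OF sq, of x] by (simp add: y_def linear_diff[OF linP] linear_diff[OF linQ] comm)
  then have "inner (P y) y + inner (Q y) y = 0"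
    by (simp add: inner_add_left[symmetric])
  then have "inner (P y) y = 0" "inner (Q y) y = 0"
    using positive_op_nonneg[OF P, of y] positive_op_nonneg[OF Q, of y] by linarith+
  then have "P y = 0" "Q y = 0"
    using positive_op_inner_eq_0 P Q by blast+
  then have "inner x (P y) - inner x (Q y) = 0" by simp
  then have "inner y y = 0"
    unfolding positive_op_symmetric[OF P, symmetric] positive_op_symmetric[OF Q, symmetric]
    by (simp add: y_def inner_diff_left)
  then show "P x = Q x" by (simp add: y_def)
qed

text \<open>After scaling, \<open>A\<close> becomes \<open>1 - B\<close> with \<open>B\<close> a
  contraction, and \<open>P\<close> is a multiple of the binomial series. The clause on
  \<open>Q\<close> prepares uniqueness: any other root commutes with \<open>A\<close>, hence with
  \<open>P\<close>.\<close>

lemma positive_sqrt_exists: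
  fixes A T :: "'a::chilbert_space \<Rightarrow> 'a"
  assumes A: "bounded_clinear A" and T: "bounded_linear T"
    and AT: "\<And>x y. inner (A x) y = inner (T x) (T y)"
  shows "\<exists>P. positive_op P \<and> P \<circ> P = A \<and>
    (\<forall>Q. bounded_linear Q \<longrightarrow> (\<forall>x. Q (A x) = A (Q x)) \<longrightarrow> (\<forall>x. Q (P x) = P (Q x)))"
proof -
  have bA: "bounded_linear A" using A by (simp add: bounded_clinear_def)
  \<comment> \<open>The summand 1 keeps the scaling factor positive when \<open>T\<close> is
    zero.\<close>
  define K where "K = onorm T + 1"
  have K: "K > 0" using onorm_pos_le[OF T] by (simp add: K_def)
  have TK: "norm (T x) \<le> K * norm x" for x
    using onorm[OF T, of x] norm_ge_zero[of x] unfolding K_def distrib_right by linarith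
  \<comment> \<open>Bounding by \<open>norm (T x)\<close> instead of \<open>norm x\<close> lets the
    quadratic term of \<open>(norm (B x))\<^sup>2\<close> be absorbed by its cross term.\<close>
  have AK: "norm (A x) \<le> K * norm (T x)" for x
  proof (cases "A x = 0")
    case False
    have "norm (A x) * norm (A x) = inner (T x) (T (A x))"
      by (simp add: AT[symmetric] power2_norm_eq_inner[unfolded power2_eq_square])
    also have "\<dots> \<le> norm (T x) * norm (T (A x))" by (rule norm_cauchy_schwarz)
    also have "\<dots> \<le> norm (T x) * (K * norm (A x))" by (intro mult_left_mono TK) simp
    finally have "norm (A x) * norm (A x) \<le> (K * norm (T x)) * norm (A x)" by (simp add: mult_ac)
    then show ?thesis using False by (simp add: mult_le_cancel_right)
  qed (use K in simp)
  define B where "B x = x - (1 / K\<^sup>2) *\<^sub>R A x" for x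
  have B: "bounded_linear B"
    unfolding B_def
    by (intro bounded_linear_sub bounded_linear_ident bounded_linear_const_scaleR bA)
  have contraction: "norm (B x) \<le> norm x" for x
  proof -
    have "(norm (B x))\<^sup>2 = (norm x)\<^sup>2 - 2 * ((norm (T x))\<^sup>2 / K\<^sup>2) + (norm (A x) / K\<^sup>2)\<^sup>2"
    proof -
      have "(norm (x - s *\<^sub>R a))\<^sup>2 = (norm x)\<^sup>2 - 2 * (s * inner a x) + (s * norm a)\<^sup>2" for s a
        unfolding power_mult_distrib power2_norm_eq_inner
        by (simp add: inner_diff_left inner_diff_right inner_commute power2_eq_square)
      then show ?thesis by (simp add: B_def AT power2_norm_eq_inner)
    qed
    moreover have "(norm (A x) / K\<^sup>2)\<^sup>2 \<le> (norm (T x))\<^sup>2 / K\<^sup>2"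
    proof -
      have "norm (A x) / K\<^sup>2 \<le> norm (T x) / K"
        using AK[of x] K by (simp add: divide_simps power2_eq_square mult_ac)
      then have "(norm (A x) / K\<^sup>2)\<^sup>2 \<le> (norm (T x) / K)\<^sup>2" by (rule power_mono) simp
      then show ?thesis by (simp add: power_divide)
    qed
    moreover have "0 \<le> (norm (T x))\<^sup>2 / K\<^sup>2" by simp
    ultimately have "(norm (B x))\<^sup>2 \<le> (norm x)\<^sup>2" by linarith
    then show ?thesis by simp
  qed
  have symB: "inner (B x) y = inner x (B y)" for x y
    using AT[of x y] AT[of y x] by (simp add: B_def inner_diff_left inner_diff_right inner_commute)
  define P where "P x = K *\<^sub>R sqrt_series B x" for x
  note bS = bounded_linear_sqrt_series[OF B contraction]
  have comm: "Q (P x) = P (Q x)" if Q: "bounded_linear Q" and QA: "\<And>x. Q (A x) = A (Q x)" for Q x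
  proof -
    note linQ = bounded_linear.linear[OF Q]
    have "Q (B y) = B (Q y)" for y
      by (simp add: B_def linear_diff[OF linQ] linear_scale[OF linQ] QA)
    then show ?thesis
      by (simp add: P_def linear_scale[OF linQ] sqrt_series_commute[OF B contraction Q])
  qed
  have "bounded_clinear P"
    unfolding bounded_clinear_def
  proof (intro conjI allI)
    show "bounded_linear P" unfolding P_def by (intro bounded_linear_const_scaleR bS)
    \<comment> \<open>Complex homogeneity is commutation with scalar multiplication, a real-linear
      operator that commutes with \<open>A\<close>.\<close>
    show "P (c *\<^sub>C x) = c *\<^sub>C P x" for c x
      by (rule comm[OF bounded_linear_scaleC, symmetric]) (use A in \<open>simp add: bounded_clinear_def\<close>)
  qed
  then have "positive_op P"
  proof (rule positive_opI)
    show "inner (P x) y = inner x (P y)" for x y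
      by (simp add: P_def sqrt_series_symmetric[OF B contraction symB])
    show "0 \<le> inner (P x) x" for x
      using K sqrt_series_nonneg[OF B contraction, of x] by (simp add: P_def)
  qed
  moreover have "P \<circ> P = A"
  proof
    fix x
    have "(P \<circ> P) x = K\<^sup>2 *\<^sub>R (x - B x)"
      by (simp add: P_def linear_scale[OF bounded_linear.linear[OF bS]]
          sqrt_series_square[OF B contraction] power2_eq_square)
    then show "(P \<circ> P) x = A x" using K by (simp add: B_def)
  qed
  ultimately show ?thesis using comm by blast
qed

section \<open>The adjoint as a bounded operator, and the modulus of \<open>T\<close>\<close>

lemma bounded_clinear_cadjoint:
  fixes T :: "'a::chilbert_space \<Rightarrow> 'a"
  assumes T: "bounded_clinear T"
  shows "bounded_clinear (cadjoint T)"
proof -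
  have bT: "bounded_linear T" using T by (simp add: bounded_clinear_def)
  note adj = cadjoint_inner[OF T, symmetric]
  have eqI: "u = v" if "\<And>x. inner x u = inner x v" for u v :: 'a
    using that by (meson vector_eq_ldot)
  have "bounded_linear (cadjoint T)"
  proof (rule bounded_linear_intro)
    show "cadjoint T (x + y) = cadjoint T x + cadjoint T y" for x y
      by (rule eqI) (simp add: adj inner_add_right)
    show "cadjoint T (r *\<^sub>R x) = r *\<^sub>R cadjoint T x" for r x
      by (rule eqI) (simp add: adj)
    show "norm (cadjoint T x) \<le> norm x * onorm T" for x
    proof (cases "cadjoint T x = 0")
      case False
      have "norm (cadjoint T x) * norm (cadjoint T x) = inner (T (cadjoint T x)) x"
        by (simp add: adj[symmetric] power2_norm_eq_inner[unfolded power2_eq_square])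
      also have "\<dots> \<le> norm (T (cadjoint T x)) * norm x" by (rule norm_cauchy_schwarz)
      also have "\<dots> \<le> (onorm T * norm (cadjoint T x)) * norm x"
        by (intro mult_right_mono onorm[OF bT]) simp
      finally have "norm (cadjoint T x) * norm (cadjoint T x) \<le> (norm x * onorm T) * norm (cadjoint T x)"
        by (simp add: mult_ac)
      then show ?thesis using False by (simp add: mult_le_cancel_right)
    qed (simp add: onorm_pos_le[OF bT])
  qed
  moreover have "cadjoint T (c *\<^sub>C x) = c *\<^sub>C cadjoint T x" for c x
  proof (rule eqI)
    fix z
    have "inner z (cadjoint T (c *\<^sub>C x)) = inner (T (cnj c *\<^sub>C z)) x"
      using T by (simp add: adj inner_scaleC_right bounded_clinear_def)
    also have "\<dots> = inner z (c *\<^sub>C cadjoint T x)"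
      by (simp add: inner_scaleC_right adj)
    finally show "inner z (cadjoint T (c *\<^sub>C x)) = inner z (c *\<^sub>C cadjoint T x)" .
  qed
  ultimately show ?thesis by (simp add: bounded_clinear_def)
qed

text \<open>The description in \<open>sqrt_op\<close> is resolved by the series root
  \<open>P\<close>: a rival root \<open>Q\<close> commutes with \<open>Q \<circ> Q\<close>, hence
  with \<open>P\<close>, and commuting positive roots coincide.\<close>

lemma
  fixes T :: "'a::chilbert_space \<Rightarrow> 'a"
  assumes T: "bounded_clinear T"
  shows positive_op_abs_op: "positive_op (abs_op T)"
    and abs_op_square: "abs_op T \<circ> abs_op T = cadjoint T \<circ> T"
proof -
  let ?A = "cadjoint T \<circ> T"
  have bT: "bounded_linear T" using T by (simp add: bounded_clinear_def)
  have A: "bounded_clinear ?A"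
    by (rule bounded_clinear_compose[OF bounded_clinear_cadjoint[OF T] T])
  have "inner (?A x) y = inner (T x) (T y)" for x y
    by (metis cadjoint_inner[OF T] comp_apply inner_commute)
  from positive_sqrt_exists[OF A bT this] obtain P where
    P: "positive_op P" "P \<circ> P = ?A"
    and comm: "\<And>Q x. bounded_linear Q \<Longrightarrow> (\<And>x. Q (?A x) = ?A (Q x)) \<Longrightarrow> Q (P x) = P (Q x)"
    by blast
  have "abs_op T = P"
    unfolding abs_op_def sqrt_op_def
  proof (rule the_equality)
    show "positive_op P \<and> P \<circ> P = ?A" using P by blast
    fix Q assume Q: "positive_op Q \<and> Q \<circ> Q = ?A"
    have "Q (?A x) = ?A (Q x)" for x
      using Q by (metis comp_apply)
    then have "Q (P x) = P (Q x)" for x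
      using Q by (intro comm) (simp_all add: positive_op_def bounded_clinear_def)
    then show "Q = P"
      using commuting_positive_sqrt_unique[of Q P] P Q by simp
  qed
  then show "positive_op (abs_op T)" "abs_op T \<circ> abs_op T = ?A" using P by simp_all
qed

lemma bounded_clinear_abs_op: "bounded_clinear T \<Longrightarrow> bounded_clinear (abs_op T)"
  using positive_op_abs_op positive_op_def by blast

lemma inner_abs_op:
  assumes T: "bounded_clinear T"
  shows "inner (abs_op T x) (abs_op T y) = inner (T x) (T y)"
proof -
  have "inner (abs_op T x) (abs_op T y) = inner x ((abs_op T \<circ> abs_op T) y)"
    by (simp add: positive_op_symmetric[OF positive_op_abs_op[OF T]])
  then show ?thesis by (simp add: abs_op_square[OF T] cadjoint_inner[OF T])
qed

lemma norm_abs_op: "bounded_clinear T \<Longrightarrow> norm (abs_op T x) = norm (T x)"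
  by (simp add: norm_eq_sqrt_inner inner_abs_op)

section \<open>Polar decomposition\<close>

text \<open>Uniqueness to go with \<open>riesz_on_range\<close>: \<open>u - v\<close> is orthogonal
  to the range, hence to \<open>u\<close> and \<open>v\<close>, hence to itself.\<close>

lemma eq_if_inner_range_eq:
  fixes u v :: "'a::real_inner"
  assumes "u \<in> closure (range L)" "v \<in> closure (range L)" "\<And>y. inner (L y) u = inner (L y) v"
  shows "u = v"
proof -
  have "inner y (u - v) = 0" if "y \<in> range L" for y
    using that assms(3) by (auto simp: inner_diff_right)
  then have "inner u (u - v) = 0" "inner v (u - v) = 0"
    using orthogonal_to_closure assms(1,2) by blast+
  then have "inner (u - v) (u - v) = 0" by (simp add: inner_diff_left)
  then show ?thesis by simp
qed

lemma subspace_closure: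
  fixes S :: "'a::real_normed_vector set"
  assumes S: "subspace S"
  shows "subspace (closure S)"
proof (rule subspaceI)
  show "0 \<in> closure S" using subspace_0[OF S] closure_subset by blast
  show "x + y \<in> closure S" if x: "x \<in> closure S" and y: "y \<in> closure S" for x y
  proof -
    obtain f where "\<And>n. f n \<in> S" "f \<longlonglongrightarrow> x"
      using x unfolding closure_sequential by blast
    moreover obtain g where "\<And>n. g n \<in> S" "g \<longlonglongrightarrow> y"
      using y unfolding closure_sequential by blast
    ultimately show ?thesis unfolding closure_sequential
      by (intro exI[of _ "\<lambda>n. f n + g n"]) (simp add: subspace_add[OF S] tendsto_add)
  qed
  show "c *\<^sub>R x \<in> closure S" if x: "x \<in> closure S" for c x
  proof -
    obtain f where "\<And>n. f n \<in> S" "f \<longlonglongrightarrow> x"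
      using x unfolding closure_sequential by blast
    then show ?thesis unfolding closure_sequential
      by (intro exI[of _ "\<lambda>n. c *\<^sub>R f n"]) (simp add: subspace_scale[OF S] tendsto_scaleR)
  qed
qed

text \<open>\<open>U\<close> is built as the adjoint of the isometry
  \<open>T y \<mapsto> P y\<close>, which defines it on the whole space at once. It is then shown to
  be the only operator meeting the description of \<open>polar_isometry T\<close>.\<close>

lemma
  fixes T :: "'a::chilbert_space \<Rightarrow> 'a"
  assumes T: "bounded_clinear T"
  shows bounded_clinear_polar_isometry: "bounded_clinear (polar_isometry T)"
    and norm_polar_isometry_le: "norm (polar_isometry T x) \<le> norm x"
proof -
  define P where "P = abs_op T"
  have P: "bounded_clinear P" using bounded_clinear_abs_op[OF T] by (simp add: P_def)
  have innerP: "inner (P x) (P y) = inner (T x) (T y)" for x y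
    by (simp add: P_def inner_abs_op[OF T])
  have normP: "norm (P x) = norm (T x)" for x by (simp add: P_def norm_abs_op[OF T])
  have symP: "inner (P x) y = inner x (P y)" for x y
    by (simp add: P_def positive_op_symmetric[OF positive_op_abs_op[OF T]])
  note linT = bounded_clinear_linear[OF T] and linP = bounded_clinear_linear[OF P]
  have bT: "bounded_linear T" using T by (simp add: bounded_clinear_def)
  \<comment> \<open>\<open>U x\<close> represents the functional \<open>T y \<mapsto> \<langle>P y, x\<rangle>\<close> on the range of \<open>T\<close>.\<close>
  have "\<exists>u\<in>closure (range T). \<forall>y. inner (T y) u = inner (P y) x" for x
  proof (rule riesz_on_range[OF linT])
    show "linear (\<lambda>y. inner (P y) x)"
      using P by (intro bounded_linear.linear bounded_linear_compose[OF bounded_linear_inner_left])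
        (simp add: bounded_clinear_def)
    show "inner (P y) x \<le> norm x * norm (T y)" for y
      using norm_cauchy_schwarz[of "P y" x] by (simp add: normP mult.commute)
  qed
  then obtain U where U_cl: "\<And>x. U x \<in> closure (range T)"
    and U: "\<And>x y. inner (T y) (U x) = inner (P y) x" by metis
  \<comment> \<open>Linearity of \<open>U\<close>, \<open>U (P x) = T x\<close> and the kernel of
    \<open>U\<close> are all obtained by checking this characterisation.\<close>
  have U_eq: "U x = u" if "u \<in> closure (range T)" "\<And>y. inner (T y) u = inner (P y) x" for x u
    by (rule eq_if_inner_range_eq[OF U_cl that(1)]) (simp add: U that(2))
  have sub: "subspace (closure (range T))"
    by (intro subspace_closure linear_subspace_image linT subspace_UNIV)
  have U_le: "norm (U x) \<le> norm x" for x
  proof -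
    obtain f where f: "\<And>n. f n \<in> range T" "f \<longlonglongrightarrow> U x"
      using U_cl[of x] unfolding closure_sequential by blast
    have le: "inner (f n) (U x) \<le> norm (f n) * norm x" for n
    proof -
      obtain y where y: "f n = T y" using f(1) by blast
      show ?thesis unfolding y U using norm_cauchy_schwarz[of "P y" x] by (simp add: normP)
    qed
    have "inner (U x) (U x) \<le> norm (U x) * norm x"
      by (rule LIMSEQ_le[of "\<lambda>n. inner (f n) (U x)" _ "\<lambda>n. norm (f n) * norm x"])
         (use le in \<open>auto intro!: tendsto_intros f(2)\<close>)
    then have "norm (U x) * norm (U x) \<le> norm (U x) * norm x"
      by (simp add: power2_norm_eq_inner[unfolded power2_eq_square])
    then show ?thesis by (cases "U x = 0") (simp_all add: mult_le_cancel_left)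
  qed
  have bU: "bounded_linear U"
  proof (rule bounded_linear_intro)
    show "U (x + y) = U x + U y" for x y
      by (rule U_eq) (simp_all add: subspace_add[OF sub] U_cl U inner_add_right)
    show "U (r *\<^sub>R x) = r *\<^sub>R U x" for r x
      by (rule U_eq) (simp_all add: subspace_scale[OF sub] U_cl U)
    show "norm (U x) \<le> norm x * 1" for x using U_le by simp
  qed
  have "U (c *\<^sub>C x) = c *\<^sub>C U x" for c x
  proof (rule U_eq)
    have "(*\<^sub>C) c ` closure (range T) \<subseteq> closure (range T)"
    proof (rule image_closure_subset)
      show "continuous_on (closure (range T)) ((*\<^sub>C) c)"
        by (rule linear_continuous_on[OF bounded_linear_scaleC])
      have "c *\<^sub>C T y = T (c *\<^sub>C y)" for y using T by (simp add: bounded_clinear_def)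
      then show "(*\<^sub>C) c ` range T \<subseteq> closure (range T)"
        using closure_subset[of "range T"] by auto
    qed simp
    then show "c *\<^sub>C U x \<in> closure (range T)" using U_cl[of x] by blast
    show "inner (T y) (c *\<^sub>C U x) = inner (P y) (c *\<^sub>C x)" for y
      using T P U[of "cnj c *\<^sub>C y" x] by (simp add: inner_scaleC_right bounded_clinear_def)
  qed
  with bU have clinU: "bounded_clinear U" by (simp add: bounded_clinear_def)
  note linU = bounded_clinear_linear[OF clinU]
  have UP: "U (P x) = T x" for x
    by (rule U_eq) (use closure_subset[of "range T"] in \<open>auto simp: innerP\<close>)
  have null_P: "P x = 0 \<longleftrightarrow> T x = 0" for x using normP[of x] by (metis norm_eq_zero)
  have null_U: "U x = 0 \<longleftrightarrow> T x = 0" for x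
  proof
    assume "U x = 0"
    then have "inner (P (P x)) x = 0" using U[of "P x" x] by simp
    then have "inner (P x) (P x) = 0" by (simp only: symP)
    then show "T x = 0" by (simp add: null_P)
  next
    assume "T x = 0"
    then have "inner (P y) x = 0" for y using null_P[of x] by (simp add: symP)
    then show "U x = 0"
      using subspace_0[OF sub] by (intro U_eq) auto
  qed
  \<comment> \<open>Riesz on the range of \<open>P\<close> acts as orthogonal projection: the
    remainder is orthogonal to that range, so by symmetry it lies in the kernel of
    \<open>P\<close>.\<close>
  have decomp: "\<exists>v\<in>closure (range P). P (x - v) = 0" for x
  proof -
    have "\<exists>v\<in>closure (range P). \<forall>y. inner (P y) v = inner (P y) x"
    proof (rule riesz_on_range[OF linP])
      show "linear (\<lambda>y. inner (P y) x)"
        using P by (intro bounded_linear.linear bounded_linear_compose[OF bounded_linear_inner_left])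
          (simp add: bounded_clinear_def)
      show "inner (P y) x \<le> norm x * norm (P y)" for y
        using norm_cauchy_schwarz[of "P y" x] by (simp add: mult.commute)
    qed
    then obtain v where v: "v \<in> closure (range P)" "\<And>y. inner (P y) (x - v) = 0"
      by (auto simp: inner_diff_right)
    have "inner (P (x - v)) (P (x - v)) = 0"
      using v(2)[of "P (x - v)"] by (simp add: symP)
    then show ?thesis using v(1) by auto
  qed
  \<comment> \<open>The codomain is general because this serves both real-valued norms and
    operators.\<close>
  have extend: "f v = g v"
    if f: "continuous_on UNIV f" and g: "continuous_on UNIV g"
      and eq: "\<And>y. f (P y) = g (P y)" and v: "v \<in> closure (range P)"
    for f g :: "'a \<Rightarrow> 'b::t2_space" and v
  proof -
    obtain h where h: "\<And>n. h n \<in> range P" "h \<longlonglongrightarrow> v"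
      using v unfolding closure_sequential by blast
    have "(\<lambda>n. f (h n)) \<longlonglongrightarrow> f v" "(\<lambda>n. g (h n)) \<longlonglongrightarrow> g v"
      using continuous_on_tendsto_compose[OF f h(2)] continuous_on_tendsto_compose[OF g h(2)] by simp_all
    moreover have "f (h n) = g (h n)" for n using h(1)[of n] eq by auto
    ultimately show ?thesis by (simp add: LIMSEQ_unique)
  qed
  have contU: "continuous_on S U" for S by (rule linear_continuous_on[OF bU])
  \<comment> \<open>Here \<open>x - v\<close> lies in the null space of \<open>U\<close>, so it is
    orthogonal to \<open>x\<close> as well as to \<open>v\<close>; thus \<open>x = v\<close>, and
    \<open>U\<close> preserves norms on the closure of the range of \<open>P\<close>.\<close>
  have isoU: "norm (U x) = norm x" if x: "\<forall>z\<in>null_space U. cinner x z = 0" for x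
  proof -
    obtain v where v: "v \<in> closure (range P)" "P (x - v) = 0" using decomp by blast
    have "cinner x (x - v) = 0" using x v(2) by (simp add: null_space_def null_U null_P)
    moreover have "inner v (x - v) = 0"
      by (rule orthogonal_to_closure[OF v(1)]) (auto simp: symP v(2))
    ultimately have "inner (x - v) (x - v) = 0" by (simp add: inner_diff_left inner_eq_Re_cinner[of x])
    then have "x = v" by simp
    have "norm (U v) = norm v"
      by (rule extend[OF _ _ _ v(1)]) (auto intro!: continuous_intros contU simp: UP normP)
    then show ?thesis by (simp add: \<open>x = v\<close>)
  qed
  have "polar_isometry T = U"
    unfolding polar_isometry_def
  proof (rule the_equality)
    show "partial_isometry U \<and> T = U \<circ> abs_op T \<and> null_space U = null_space T"
      using clinU isoU UP by (auto simp: partial_isometry_def null_space_def null_U simp flip: P_def)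
    \<comment> \<open>Both \<open>V\<close> and \<open>U\<close> send \<open>P y\<close> to
      \<open>T y\<close> and kill the kernel of \<open>P\<close>, so they agree on both parts of the
      decomposition.\<close>
    fix V assume V: "partial_isometry V \<and> T = V \<circ> abs_op T \<and> null_space V = null_space T"
    then have clinV: "bounded_clinear V" by (simp add: partial_isometry_def)
    note linV = bounded_clinear_linear[OF clinV]
    have VP: "V (P y) = U (P y)" for y using V UP by (metis P_def comp_apply)
    have null_V: "V y = 0 \<longleftrightarrow> T y = 0" for y using V by (auto simp: null_space_def)
    show "V = U"
    proof
      fix x
      obtain v where v: "v \<in> closure (range P)" "P (x - v) = 0" using decomp by blast
      have "V v = U v"
        by (rule extend[OF _ contU VP v(1)])
           (use clinV in \<open>simp add: bounded_clinear_def linear_continuous_on\<close>)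
      moreover have "V (x - v) = 0" "U (x - v) = 0"
        using v(2) by (simp_all add: null_V null_U null_P)
      ultimately show "V x = U x" by (simp add: linear_diff[OF linV] linear_diff[OF linU])
    qed
  qed
  then show "bounded_clinear (polar_isometry T)" "norm (polar_isometry T x) \<le> norm x"
    using clinU U_le by simp_all
qed

section \<open>The mean transform\<close>

lemma bounded_clinear_duggal_transform:
  "bounded_clinear T \<Longrightarrow> bounded_clinear (duggal_transform T)"
  unfolding duggal_transform_def
  by (intro bounded_clinear_compose bounded_clinear_abs_op bounded_clinear_polar_isometry)

lemma norm_duggal_transform_le:
  assumes T: "bounded_clinear T"
  shows "norm (duggal_transform T x) \<le> onorm T * norm x"
proof -
  have bT: "bounded_linear T" using T by (simp add: bounded_clinear_def)
  have "norm (duggal_transform T x) = norm (T (polar_isometry T x))"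
    by (simp add: duggal_transform_def norm_abs_op[OF T])
  also have "\<dots> \<le> onorm T * norm (polar_isometry T x)" by (rule onorm[OF bT])
  also have "\<dots> \<le> onorm T * norm x"
    by (intro mult_left_mono norm_polar_isometry_le[OF T] onorm_pos_le[OF bT])
  finally show ?thesis .
qed

text \<open>If every unit vector stayed a fixed amount below the norm, homogeneity would turn the
  smaller constant into an operator bound.\<close>

lemma onorm_approx_sequence:
  fixes S :: "'a::real_normed_vector \<Rightarrow> 'b::real_normed_vector"
  assumes S: "bounded_linear S" and nontrivial: "\<exists>v::'a. v \<noteq> 0"
  shows "\<exists>x. (\<forall>n. norm (x n) = 1) \<and> (\<lambda>n. norm (S (x n))) \<longlonglongrightarrow> onorm S"
proof -
  have "\<exists>x. norm x = 1 \<and> onorm S - inverse (real (Suc n)) < norm (S x)" for n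
  proof (rule ccontr)
    assume "\<not> ?thesis"
    then have le: "norm (S x) \<le> onorm S - inverse (real (Suc n))" if "norm x = 1" for x
      using that by (meson not_less)
    obtain v :: 'a where "v \<noteq> 0" using nontrivial by blast
    \<comment> \<open>\<open>onorm_bound\<close> asks for a nonnegative constant; the existence of a
      unit vector provides it.\<close>
    then have "0 \<le> onorm S - inverse (real (Suc n))"
      by (intro order_trans[OF norm_ge_zero le[of "sgn v"]]) (simp add: norm_sgn)
    then have "onorm S \<le> onorm S - inverse (real (Suc n))"
    proof (rule onorm_bound)
      fix x :: 'a
      show "norm (S x) \<le> (onorm S - inverse (real (Suc n))) * norm x"
      proof (cases "x = 0")
        case False
        then show ?thesis
          using le[of "sgn x"]
          by (simp add: sgn_div_norm norm_sgn linear_scale[OF bounded_linear.linear[OF S]] field_simps)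
      qed (simp add: linear_0[OF bounded_linear.linear[OF S]])
    qed
    then show False by (simp add: not_le)
  qed
  then obtain x where x: "\<And>n. norm (x n) = 1"
    and lower: "\<And>n. onorm S - inverse (real (Suc n)) < norm (S (x n))" by metis
  have "norm (S (x n)) \<le> onorm S" for n using onorm[OF S, of "x n"] by (simp add: x)
  then have "(\<lambda>n. norm (S (x n))) \<longlonglongrightarrow> onorm S"
    using lower
    by (intro tendsto_sandwich[OF _ _ LIMSEQ_inverse_real_of_nat_add_minus tendsto_const])
       (auto intro!: always_eventually less_imp_le)
  with x show ?thesis by blast
qed

text \<open>The bound on the modulus leaves at most \<open>r\<^sup>2 - (Re (z n))\<^sup>2\<close>
  for the squared imaginary part, and this tends to 0.\<close>

lemma tendsto_complex_of_real_of_Re: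
  assumes Re: "(\<lambda>n. Re (z n)) \<longlonglongrightarrow> r" and le: "\<And>n. cmod (z n) \<le> r"
  shows "z \<longlonglongrightarrow> complex_of_real r"
proof -
  have sq: "\<bar>Im (z n)\<bar> \<le> sqrt (r\<^sup>2 - (Re (z n))\<^sup>2)" for n
  proof (rule real_le_rsqrt)
    have "(cmod (z n))\<^sup>2 \<le> r\<^sup>2" by (rule power_mono[OF le]) simp
    then show "\<bar>Im (z n)\<bar>\<^sup>2 \<le> r\<^sup>2 - (Re (z n))\<^sup>2" by (simp add: cmod_power2)
  qed
  have "(\<lambda>n. sqrt (r\<^sup>2 - (Re (z n))\<^sup>2)) \<longlonglongrightarrow> sqrt (r\<^sup>2 - r\<^sup>2)"
    by (intro tendsto_intros Re)
  then have "(\<lambda>n. sqrt (r\<^sup>2 - (Re (z n))\<^sup>2)) \<longlonglongrightarrow> 0" by simp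
  then have "(\<lambda>n. Im (z n)) \<longlonglongrightarrow> 0"
    by (rule Lim_null_comparison[rotated]) (use sq in simp)
  with Re show ?thesis unfolding tendsto_complex_iff by simp
qed

theorem theorem3p9:
  fixes T :: "'a::chilbert_space \<Rightarrow> 'a" and t :: real
  assumes nontrivial: "\<exists>v::'a. v \<noteq> 0"
    and T: "bounded_clinear T"
    and t: "t \<in> {0<..<1}"
  shows "onorm (mean_transform t T) = onorm T \<longleftrightarrow>
    (\<exists>x::nat \<Rightarrow> 'a. (\<forall>n. norm (x n) = 1) \<and>
      (\<lambda>n. cinner (T (x n)) (duggal_transform T (x n))) \<longlonglongrightarrow> complex_of_real ((onorm T)\<^sup>2))"
proof -
  define D where "D = duggal_transform T"
  define M where "M = mean_transform t T"
  define K where "K = onorm T"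
  have bT: "bounded_linear T" using T by (simp add: bounded_clinear_def)
  have bD: "bounded_linear D"
    using bounded_clinear_duggal_transform[OF T] by (simp add: D_def bounded_clinear_def)
  have M: "M x = t *\<^sub>R T x + (1 - t) *\<^sub>R D x" for x
    by (simp add: M_def D_def mean_transform_def)
  have bM: "bounded_linear M"
    unfolding M by (intro bounded_linear_add bounded_linear_const_scaleR bT bD)
  have t0: "0 < t" "0 < 1 - t" using t by auto
  have K0: "0 \<le> K" by (simp add: K_def onorm_pos_le[OF bT])
  have T_le: "norm (T x) \<le> K" and D_le: "norm (D x) \<le> K" if "norm x = 1" for x
    using onorm[OF bT, of x] norm_duggal_transform_le[OF T, of x] that by (simp_all add: K_def D_def)
  have M_sq: "(norm (M x))\<^sup>2 = t\<^sup>2 * (norm (T x))\<^sup>2 + (1 - t)\<^sup>2 * (norm (D x))\<^sup>2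
      + 2 * t * (1 - t) * inner (T x) (D x)" for x
    unfolding M power2_norm_eq_inner
    by (simp add: inner_add_left inner_add_right inner_commute power2_eq_square algebra_simps)
  have M_le: "onorm M \<le> K"
  proof (rule onorm_bound[OF K0])
    fix x
    have "norm (M x) \<le> t * norm (T x) + (1 - t) * norm (D x)"
      unfolding M using t0 by (intro norm_triangle_le) simp
    also have "\<dots> \<le> t * (K * norm x) + (1 - t) * (K * norm x)"
      using t0 onorm[OF bT, of x] norm_duggal_transform_le[OF T, of x]
      by (intro add_mono mult_left_mono) (simp_all add: K_def D_def)
    finally show "norm (M x) \<le> K * norm x" by (simp add: algebra_simps)
  qed
  have "onorm M = K \<longleftrightarrow> (\<exists>x. (\<forall>n. norm (x n) = 1) \<and>
      (\<lambda>n. cinner (T (x n)) (D (x n))) \<longlonglongrightarrow> complex_of_real (K\<^sup>2))"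
  proof
    assume eq: "onorm M = K"
    then obtain x where x: "\<And>n. norm (x n) = 1" and lim: "(\<lambda>n. norm (M (x n))) \<longlonglongrightarrow> K"
      using onorm_approx_sequence[OF bM nontrivial] by metis
    have bound: "cmod (cinner (T (x n)) (D (x n))) \<le> K\<^sup>2" for n
      unfolding power2_eq_square
      by (rule order_trans[OF norm_cinner_le mult_mono[OF T_le D_le]]) (simp_all add: x K0)
    have upper: "inner (T (x n)) (D (x n)) \<le> K\<^sup>2" for n
      using bound[of n] complex_Re_le_cmod[of "cinner (T (x n)) (D (x n))"]
      by (simp add: inner_eq_Re_cinner)
    \<comment> \<open>\<open>M_sq\<close> solved for the inner product, with both squared norms
      replaced by their maximum \<open>K\<^sup>2\<close>.\<close>
    have lower: "((norm (M (x n)))\<^sup>2 - (t\<^sup>2 + (1 - t)\<^sup>2) * K\<^sup>2) / (2 * t * (1 - t)) \<le> inner (T (x n)) (D (x n))" for n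
    proof -
      have "(norm (T (x n)))\<^sup>2 \<le> K\<^sup>2" "(norm (D (x n)))\<^sup>2 \<le> K\<^sup>2"
        by (simp_all add: power_mono T_le D_le x)
      then have "t\<^sup>2 * (norm (T (x n)))\<^sup>2 + (1 - t)\<^sup>2 * (norm (D (x n)))\<^sup>2 \<le> t\<^sup>2 * K\<^sup>2 + (1 - t)\<^sup>2 * K\<^sup>2"
        by (intro add_mono mult_left_mono) simp_all
      then have "(norm (M (x n)))\<^sup>2 - (t\<^sup>2 + (1 - t)\<^sup>2) * K\<^sup>2 \<le> inner (T (x n)) (D (x n)) * (2 * t * (1 - t))"
        unfolding M_sq by (simp add: algebra_simps)
      then show ?thesis using t0 by (simp add: pos_divide_le_eq)
    qed
    have "(\<lambda>n. ((norm (M (x n)))\<^sup>2 - (t\<^sup>2 + (1 - t)\<^sup>2) * K\<^sup>2) / (2 * t * (1 - t)))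
        \<longlonglongrightarrow> (K\<^sup>2 - (t\<^sup>2 + (1 - t)\<^sup>2) * K\<^sup>2) / (2 * t * (1 - t))"
      using t0 by (intro tendsto_intros lim) auto
    \<comment> \<open>The three weights \<open>t\<^sup>2\<close>, \<open>(1 - t)\<^sup>2\<close> and
      \<open>2 * t * (1 - t)\<close> add up to 1.\<close>
    also have "K\<^sup>2 - (t\<^sup>2 + (1 - t)\<^sup>2) * K\<^sup>2 = K\<^sup>2 * (2 * t * (1 - t))"
      by (simp add: power2_eq_square algebra_simps)
    finally have low_lim: "(\<lambda>n. ((norm (M (x n)))\<^sup>2 - (t\<^sup>2 + (1 - t)\<^sup>2) * K\<^sup>2) / (2 * t * (1 - t))) \<longlonglongrightarrow> K\<^sup>2"
      using t0 by simp
    have "(\<lambda>n. inner (T (x n)) (D (x n))) \<longlonglongrightarrow> K\<^sup>2"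
      by (rule tendsto_sandwich[OF _ _ low_lim tendsto_const])
         (use lower upper in \<open>auto intro: always_eventually\<close>)
    then have "(\<lambda>n. cinner (T (x n)) (D (x n))) \<longlonglongrightarrow> complex_of_real (K\<^sup>2)"
      by (intro tendsto_complex_of_real_of_Re bound) (simp add: inner_eq_Re_cinner)
    with x show "\<exists>x. (\<forall>n. norm (x n) = 1) \<and>
      (\<lambda>n. cinner (T (x n)) (D (x n))) \<longlonglongrightarrow> complex_of_real (K\<^sup>2)" by blast
  next
    assume "\<exists>x. (\<forall>n. norm (x n) = 1) \<and>
      (\<lambda>n. cinner (T (x n)) (D (x n))) \<longlonglongrightarrow> complex_of_real (K\<^sup>2)"
    then obtain x where x: "\<And>n. norm (x n) = 1"
      and lim: "(\<lambda>n. cinner (T (x n)) (D (x n))) \<longlonglongrightarrow> complex_of_real (K\<^sup>2)" by blast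
    \<comment> \<open>Each of the two squared norms is at least
      \<open>2 * inner (T (x n)) (D (x n)) - K\<^sup>2\<close>, as the other is at most
      \<open>K\<^sup>2\<close>. Inserted in \<open>M_sq\<close>, this gives a lower bound in the
      inner product alone, with limit \<open>K\<^sup>2\<close>.\<close>
    have le: "(t\<^sup>2 + (1 - t)\<^sup>2) * (2 * inner (T (x n)) (D (x n)) - K\<^sup>2)
        + 2 * t * (1 - t) * inner (T (x n)) (D (x n)) \<le> (onorm M)\<^sup>2" for n
    proof -
      have "0 \<le> (norm (T (x n) - D (x n)))\<^sup>2" by simp
      also have "\<dots> = (norm (T (x n)))\<^sup>2 + (norm (D (x n)))\<^sup>2 - 2 * inner (T (x n)) (D (x n))"
        unfolding power2_norm_eq_inner by (simp add: inner_diff_left inner_diff_right inner_commute)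
      finally have "2 * inner (T (x n)) (D (x n)) \<le> (norm (T (x n)))\<^sup>2 + (norm (D (x n)))\<^sup>2" by simp
      moreover have "(norm (T (x n)))\<^sup>2 \<le> K\<^sup>2" "(norm (D (x n)))\<^sup>2 \<le> K\<^sup>2"
        by (simp_all add: power_mono T_le D_le x)
      ultimately have "t\<^sup>2 * (2 * inner (T (x n)) (D (x n)) - K\<^sup>2)
          + (1 - t)\<^sup>2 * (2 * inner (T (x n)) (D (x n)) - K\<^sup>2)
          \<le> t\<^sup>2 * (norm (T (x n)))\<^sup>2 + (1 - t)\<^sup>2 * (norm (D (x n)))\<^sup>2"
        by (intro add_mono mult_left_mono) simp_all
      then have "(t\<^sup>2 + (1 - t)\<^sup>2) * (2 * inner (T (x n)) (D (x n)) - K\<^sup>2)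
          + 2 * t * (1 - t) * inner (T (x n)) (D (x n)) \<le> (norm (M (x n)))\<^sup>2"
        unfolding M_sq by (simp add: distrib_right)
      also have "\<dots> \<le> (onorm M)\<^sup>2"
        using onorm[OF bM, of "x n"] by (intro power_mono) (simp_all add: x)
      finally show ?thesis .
    qed
    have "(\<lambda>n. inner (T (x n)) (D (x n))) \<longlonglongrightarrow> K\<^sup>2"
      using tendsto_Re[OF lim] by (simp add: inner_eq_Re_cinner)
    then have "(\<lambda>n. (t\<^sup>2 + (1 - t)\<^sup>2) * (2 * inner (T (x n)) (D (x n)) - K\<^sup>2)
        + 2 * t * (1 - t) * inner (T (x n)) (D (x n)))
      \<longlonglongrightarrow> (t\<^sup>2 + (1 - t)\<^sup>2) * (2 * K\<^sup>2 - K\<^sup>2) + 2 * t * (1 - t) * K\<^sup>2"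
      by (intro tendsto_intros)
    also have "(t\<^sup>2 + (1 - t)\<^sup>2) * (2 * K\<^sup>2 - K\<^sup>2) + 2 * t * (1 - t) * K\<^sup>2 = K\<^sup>2"
      by (simp add: power2_eq_square algebra_simps)
    finally have "K\<^sup>2 \<le> (onorm M)\<^sup>2" by (rule LIMSEQ_le_const2) (use le in blast)
    then have "K \<le> onorm M" by (rule power2_le_imp_le) (rule onorm_pos_le[OF bM])
    with M_le show "onorm M = K" by simp
  qed
  then show ?thesis by (simp add: M_def D_def K_def)
qed

end
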